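(* Let $\ell_1,\dots,\ell_n:\mathbb{R}^d\to\mathbb{R}$ and $f=\frac1n\sum_{i=1}^n\ell_i$ satisfy Assumptions A and B of the context, and suppose that the problem has full minimizer coherence, i.e. $\sup_{\theta\in\Theta^*}\ell_i(\theta)=\ell_i^*$ for all $i=1,\dots,n$. Let $0<\eta\le \frac1L$ and let $\{\theta_k\}_{k\ge 0}$ be any trajectory generated by SGD with random reshuffle with step size $\eta$ from an arbitrary initial point $\theta_0\in\mathbb{R}^d$ (i.e. for any realization of the permutations). Then $\{\theta_k\}_k$ converges to some point of $\Theta^*$.
   Context: Problem: minimize $f(\theta)=\frac1n\sum_{i=1}^n \ell_i(\theta)$ over $\theta\in\mathbb{R}^d$, where each $\ell_i:\mathbb{R}^d\to\mathbb{R}$ is differentiable. Assumption A (existence): each $\ell_i$ attains its global minimum $\ell_i^*>-\infty$, with nonempty set of global minimizers $\Theta_i^*\subset\mathbb{R}^d$; $f$ attains its global minimum $f^*>-\infty$, with nonempty set of global minimizers $\Theta^*\subset\mathbb{R}^d$. Assumption B: there are constants $L>0$ and $0<\mu_i\le L$ ($i=1,\dots,n$) such that for every $i$: (1) ($L$-smoothness) $\ell_i(x)\le \ell_i(y)+\langle x-y,\nabla\ell_i(y)\rangle+\frac L2\|x-y\|^2$ for all $x,y\in\mathbb{R}^d$; (2) ($\mu_i$-weak strong convexity) $\ell_i(\omega)\ge \ell_i(x)+\langle\omega-x,\nabla\ell_i(x)\rangle+\frac{\mu_i}{2}\|x-\omega\|^2$ for all $x\in\mathbb{R}^d$ and all $\omega\in\mathrm{proj}_{\Theta_i^*}(x)\cup\mathrm{proj}_{\Theta^*}(x)$,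 where $\mathrm{proj}_A(x)$ is the set of Euclidean projections (nearest points) of $x$ onto $A$. SGD: $\theta_{k+1}=\theta_k-\eta\nabla\ell_{\xi(k)}(\theta_k)$, $k=0,1,\dots$. Random reshuffle: at the start of each epoch (block of $n$ consecutive iterations $nB,\dots,n(B+1)-1$, $B=0,1,\dots$) a random permutation of $\{1,\dots,n\}$ is drawn, and $(\xi(nB),\dots,\xi(n(B+1)-1))$ is that permutation; so each index is used exactly once per epoch. *)

theory Defs
  imports "HOL-Analysis.Analysis"
begin

definition grad :: "(real ^ 'd \<Rightarrow> real) \<Rightarrow> real ^ 'd \<Rightarrow> real ^ 'd" where
  "grad g x = (THE D. GDERIV g x :> D)"

lemma GDERIV_unique:
  fixes g :: "real ^ 'd \<Rightarrow> real"
  assumes "GDERIV g x :> D" "GDERIV g x :> D'"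
  shows "D = D'"
proof -
  have "(\<lambda>h. h \<bullet> D) = (\<lambda>h. h \<bullet> D')"
    using assms unfolding gderiv_def by (rule has_derivative_unique)
  then have "\<forall>h. h \<bullet> D = h \<bullet> D'"
    by meson
  then show ?thesis
    by (rule vector_eq_ldot[THEN iffD1])
qed

lemma GDERIV_grad:
  fixes g :: "real ^ 'd \<Rightarrow> real"
  assumes "g differentiable (at x)"
  shows "GDERIV g x :> grad g x"
proof -
  obtain g' where g': "(g has_derivative g') (at x)"
    using assms unfolding differentiable_def by blast
  then have "linear g'"
    by (rule has_derivative_linear)
  then have "g' h = h \<bullet> adjoint g' 1" for h
    using adjoint_works[of g' h 1] by simp
  then obtain D where "g' = (\<lambda>h. h \<bullet> D)"
    by blast
  with g' have "GDERIV g x :> D"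
    unfolding gderiv_def by simp
  then have "\<exists>!D. GDERIV g x :> D"
    using GDERIV_unique by blast
  then show ?thesis
    unfolding grad_def by (rule theI')
qed

definition minimizers :: "('a \<Rightarrow> real) \<Rightarrow> 'a set" where
  "minimizers g = {x. \<forall>y. g x \<le> g y}"

text \<open>The set of all nearest points of \<open>A\<close> to \<open>x\<close>; since \<open>A\<close> need not be convex there may be
  several, so \<^const>\<open>closest_point\<close>, which selects one, is not suitable.\<close>

definition proj :: "'a::metric_space set \<Rightarrow> 'a \<Rightarrow> 'a set" where
  "proj A x = {w \<in> A. \<forall>a\<in>A. dist x w \<le> dist x a}"

definition objective :: "nat \<Rightarrow> (nat \<Rightarrow> real ^ 'd \<Rightarrow> real) \<Rightarrow> real ^ 'd \<Rightarrow> real" where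
  "objective n l \<theta> = 1 / real n * (\<Sum>i=1..n. l i \<theta>)"

definition L_smooth :: "real \<Rightarrow> (real ^ 'd \<Rightarrow> real) \<Rightarrow> bool" where
  "L_smooth L g \<longleftrightarrow>
    (\<forall>x y. g x \<le> g y + (x - y) \<bullet> grad g y + L / 2 * (norm (x - y))\<^sup>2)"

text \<open>The second argument is the minimizer set of the full objective, which need not be related to
  that of \<open>g\<close>.\<close>

definition weakly_strongly_convex ::
  "real \<Rightarrow> (real ^ 'd) set \<Rightarrow> (real ^ 'd \<Rightarrow> real) \<Rightarrow> bool" where
  "weakly_strongly_convex m \<Theta> g \<longleftrightarrow>
    (\<forall>x. \<forall>w \<in> proj (minimizers g) x \<union> proj \<Theta> x.
       g w \<ge> g x + (w - x) \<bullet> grad g x + m / 2 * (norm (x - w))\<^sup>2)"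

text \<open>Supremum and infimum are taken in the extended reals because \<open>l i\<close> may a priori be unbounded
  on the minimizer set of the objective, where the real supremum is unspecified.\<close>

definition full_minimizer_coherence :: "nat \<Rightarrow> (nat \<Rightarrow> real ^ 'd \<Rightarrow> real) \<Rightarrow> bool" where
  "full_minimizer_coherence n l \<longleftrightarrow>
    (\<forall>i\<in>{1..n}. (SUP \<theta>\<in>minimizers (objective n l). ereal (l i \<theta>)) = (INF \<theta>. ereal (l i \<theta>)))"

text \<open>\<open>\<xi>\<close> is one realization of the sampled indices; epoch \<open>B\<close> runs through the values
  \<open>\<pi> 1, \<dots>, \<pi> n\<close> of its permutation \<open>\<pi>\<close>.\<close>

definition reshuffle_schedule :: "nat \<Rightarrow> (nat \<Rightarrow> nat) \<Rightarrow> bool" where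
  "reshuffle_schedule n \<xi> \<longleftrightarrow>
    (\<forall>B. \<exists>\<pi>. \<pi> permutes {1..n} \<and> (\<forall>j<n. \<xi> (n * B + j) = \<pi> (j + 1)))"

definition SGD_trajectory ::
  "(nat \<Rightarrow> real ^ 'd \<Rightarrow> real) \<Rightarrow> real \<Rightarrow> (nat \<Rightarrow> nat) \<Rightarrow> (nat \<Rightarrow> real ^ 'd) \<Rightarrow> bool" where
  "SGD_trajectory l \<eta> \<xi> \<theta> \<longleftrightarrow>
    (\<forall>k. \<theta> (Suc k) = \<theta> k - \<eta> *\<^sub>R grad (l (\<xi> k)) (\<theta> k))"

end

theory Submission
  imports Defs
begin

text \<open>
  Let \<open>\<Theta>\<close> be the minimizer set of the objective. Coherence makes every point of \<open>\<Theta>\<close> a minimizer of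
  every \<open>l i\<close>, so all the individual gradient steps pull towards the common set \<open>\<Theta>\<close>. If \<open>w\<close> is a
  nearest point of \<open>\<Theta>\<close> to \<open>x\<close>, expand \<open>norm (x - \<eta> \<nabla>l\<^sub>i(x) - w)\<^sup>2\<close>: weak strong convexity bounds the
  inner product from below by the gap \<open>l\<^sub>i(x) - l\<^sub>i(w)\<close> plus \<open>\<mu>\<^sub>i / 2\<close> times the squared distance, and
  smoothness bounds the squared gradient by \<open>2 L\<close> times the same gap. As \<open>\<eta> L \<le> 1\<close>, the gap is
  absorbed and each single step multiplies the squared distance to \<open>\<Theta>\<close> by at most \<open>1 - \<eta> \<mu>\<^sub>i\<close>
  (lemma \<open>gradient_step_infdist_contracts\<close>).

  Contraction of the distance to \<open>\<Theta>\<close> does not by itself give convergence of the iterates, since they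
  could drift along \<open>\<Theta>\<close>. But smoothness also bounds the length of a step by \<open>\<eta> L\<close> times the distance
  to \<open>\<Theta>\<close> (lemma \<open>gradient_norm_le_infdist\<close>), so the step lengths decay geometrically, the trajectory
  has finite length, and its limit is at distance zero from the closed set \<open>\<Theta>\<close>
  (lemma \<open>convergent_if_infdist_contracts\<close>).

  Every index drawn lies in \<open>{1..n}\<close>, so the smallest \<open>\<mu>\<^sub>i\<close> gives a contraction factor that is the
  same for all steps and realizations.
\<close>

lemma closed_minimizers:
  fixes g :: "'a::topological_space \<Rightarrow> real"
  assumes "continuous_on UNIV g"
  shows "closed (minimizers g)"
  unfolding minimizers_def
  by (intro closed_Collect_all closed_Collect_le assms continuous_on_const)

lemma infdist_attained_on_proj:
  fixes S :: "'a::heine_borel set"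
  assumes "closed S" "S \<noteq> {}"
  obtains w where "w \<in> proj S x" "infdist x S = dist x w"
proof -
  obtain w where w: "w \<in> S" "infdist x S = dist x w"
    using infdist_attains_inf[OF assms] by blast
  then have "w \<in> proj S x"
    unfolding proj_def using infdist_le[of _ S x] by fastforce
  with w(2) show ?thesis
    using that by blast
qed

text \<open>Coherence is stated through a supremum, but that supremum equals the infimum of \<open>l i\<close>, which
  leaves no room for \<open>l i\<close> to vary on the minimizer set of the objective.\<close>

lemma coherence_common_minimizers:
  assumes "full_minimizer_coherence n l" "i \<in> {1..n}"
  shows "minimizers (objective n l) \<subseteq> minimizers (l i)"
proof
  fix w assume w: "w \<in> minimizers (objective n l)"
  have "l i w \<le> l i y" for y
  proof -
    have "ereal (l i w) \<le> (SUP \<theta>\<in>minimizers (objective n l). ereal (l i \<theta>))"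
      using w by (rule SUP_upper)
    also have "\<dots> = (INF \<theta>. ereal (l i \<theta>))"
      using assms unfolding full_minimizer_coherence_def by blast
    also have "\<dots> \<le> ereal (l i y)"
      by (rule INF_lower) simp
    finally show ?thesis by simp
  qed
  then show "w \<in> minimizers (l i)"
    unfolding minimizers_def by blast
qed

text \<open>A step of length \<open>1 / L\<close> along the negative gradient lowers the value by at least
  \<open>norm (grad g x)\<^sup>2 / (2 L)\<close>, and it cannot go below the minimum.\<close>

lemma gradient_norm_le_gap:
  assumes "L_smooth L g" "L > 0" "w \<in> minimizers g"
  shows "(norm (grad g x))\<^sup>2 \<le> 2 * L * (g x - g w)"
proof -
  let ?d = "grad g x"
  let ?y = "x - (1 / L) *\<^sub>R ?d"
  have "g w \<le> g ?y"
    using assms(3) unfolding minimizers_def by blast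
  also have "\<dots> \<le> g x + (?y - x) \<bullet> ?d + L / 2 * (norm (?y - x))\<^sup>2"
    using assms(1) unfolding L_smooth_def by blast
  also have "\<dots> = g x - (norm ?d)\<^sup>2 / (2 * L)"
    using assms(2)
    by (simp add: power_mult_distrib power2_norm_eq_inner[symmetric] power2_eq_square field_simps)
  finally show ?thesis
    using assms(2) by (simp add: field_simps)
qed

text \<open>Smoothness around a minimizer \<open>w\<close>, where the gradient vanishes, bounds the gap at \<open>x\<close> by
  \<open>L / 2 * (norm (x - w))\<^sup>2\<close>; the previous lemma turns this into a bound on the gradient.\<close>

lemma gradient_norm_le_dist:
  assumes "L_smooth L g" "L > 0" "w \<in> minimizers g"
  shows "norm (grad g x) \<le> L * dist x w"
proof -
  have "grad g w = 0"
    using gradient_norm_le_gap[OF assms, of w] by simp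
  moreover have "g x \<le> g w + (x - w) \<bullet> grad g w + L / 2 * (norm (x - w))\<^sup>2"
    using assms(1) unfolding L_smooth_def by blast
  ultimately have gap: "g x - g w \<le> L / 2 * (norm (x - w))\<^sup>2"
    by simp
  have "(norm (grad g x))\<^sup>2 \<le> 2 * L * (g x - g w)"
    by (rule gradient_norm_le_gap[OF assms])
  also have "\<dots> \<le> 2 * L * (L / 2 * (norm (x - w))\<^sup>2)"
    using gap assms(2) by (intro mult_left_mono) auto
  also have "\<dots> = (L * dist x w)\<^sup>2"
    by (simp add: dist_norm power2_eq_square)
  finally show ?thesis
    by (rule power2_le_imp_le) (use assms(2) in simp)
qed

lemma gradient_norm_le_infdist:
  assumes "L_smooth L g" "L > 0" "closed S" "S \<noteq> {}" "S \<subseteq> minimizers g"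
  shows "norm (grad g x) \<le> L * infdist x S"
proof -
  obtain w where "w \<in> proj S x" "infdist x S = dist x w"
    using infdist_attained_on_proj[OF assms(3,4)] .
  then show ?thesis
    using gradient_norm_le_dist[OF assms(1,2)] assms(5) unfolding proj_def by force
qed

text \<open>The weak strong convexity inequality is only available at nearest points of \<open>S\<close>. One such point
  suffices: the distance from the new iterate to it is an upper bound for the new distance to
  \<open>S\<close>.\<close>

lemma gradient_step_infdist_contracts:
  assumes "L_smooth L g" "L > 0" "weakly_strongly_convex m S g"
    and "closed S" "S \<noteq> {}" "S \<subseteq> minimizers g"
    and "0 < \<eta>" "\<eta> \<le> 1 / L"
  shows "(infdist (x - \<eta> *\<^sub>R grad g x) S)\<^sup>2 \<le> (1 - \<eta> * m) * (infdist x S)\<^sup>2"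
proof -
  let ?d = "grad g x"
  obtain w where w: "w \<in> proj S x" and dist_w: "infdist x S = dist x w"
    using infdist_attained_on_proj[OF assms(4,5)] .
  have wS: "w \<in> S"
    using w unfolding proj_def by blast
  then have wmin: "w \<in> minimizers g"
    using assms(6) by blast
  define gap where "gap = g x - g w"
  have gap: "gap \<ge> 0"
    using wmin unfolding gap_def minimizers_def by simp
  have "g w \<ge> g x + (w - x) \<bullet> ?d + m / 2 * (norm (x - w))\<^sup>2"
    using assms(3) w unfolding weakly_strongly_convex_def by blast
  then have inner: "(x - w) \<bullet> ?d \<ge> gap + m / 2 * (norm (x - w))\<^sup>2"
    unfolding gap_def by (simp add: inner_diff_left)
  have "(norm ?d)\<^sup>2 \<le> 2 * L * gap"
    unfolding gap_def by (rule gradient_norm_le_gap[OF assms(1,2) wmin])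
  then have "\<eta> * (norm ?d)\<^sup>2 \<le> \<eta> * (2 * L * gap)"
    using assms(7) by (intro mult_left_mono) auto
  also have "\<dots> = (\<eta> * L) * (2 * gap)"
    by simp
  also have "\<dots> \<le> 1 * (2 * gap)"
    using assms(2,8) gap by (intro mult_right_mono) (auto simp: field_simps)
  finally have grad_sq: "\<eta> * (norm ?d)\<^sup>2 \<le> 2 * gap"
    by simp
  have "(infdist (x - \<eta> *\<^sub>R ?d) S)\<^sup>2 \<le> (dist (x - \<eta> *\<^sub>R ?d) w)\<^sup>2"
    by (intro power_mono infdist_le wS infdist_nonneg)
  also have "\<dots> = (norm ((x - w) - \<eta> *\<^sub>R ?d))\<^sup>2"
    by (simp add: dist_norm algebra_simps)
  also have "\<dots> = (norm (x - w))\<^sup>2 + \<eta> * (\<eta> * (norm ?d)\<^sup>2 - 2 * ((x - w) \<bullet> ?d))"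
    unfolding power2_norm_eq_inner by (simp add: inner_diff inner_commute algebra_simps)
  also have "\<dots> \<le> (norm (x - w))\<^sup>2 + \<eta> * (- m * (norm (x - w))\<^sup>2)"
    using inner grad_sq assms(7) by (intro add_left_mono mult_left_mono) auto
  also have "\<dots> = (1 - \<eta> * m) * (infdist x S)\<^sup>2"
    by (simp add: dist_w dist_norm algebra_simps)
  finally show ?thesis .
qed

text \<open>A sequence whose steps are controlled by its distance to \<open>S\<close> cannot drift along \<open>S\<close> once that
  distance decays geometrically: the increments are absolutely summable.\<close>

lemma convergent_if_infdist_contracts:
  fixes z :: "nat \<Rightarrow> 'a::banach"
  assumes "closed S" "S \<noteq> {}" "0 \<le> q" "q < 1"
    and contr: "\<And>k. infdist (z (Suc k)) S \<le> q * infdist (z k) S"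
    and step: "\<And>k. norm (z (Suc k) - z k) \<le> C * infdist (z k) S"
  shows "\<exists>s\<in>S. z \<longlonglongrightarrow> s"
proof -
  have geometric: "infdist (z k) S \<le> infdist (z 0) S * q ^ k" for k
  proof (induction k)
    case (Suc k)
    have "infdist (z (Suc k)) S \<le> q * infdist (z k) S"
      by (rule contr)
    also have "\<dots> \<le> q * (infdist (z 0) S * q ^ k)"
      using Suc.IH assms(3) by (rule mult_left_mono)
    finally show ?case
      by (simp add: mult_ac)
  qed simp
  have summable_bound: "summable (\<lambda>k. infdist (z 0) S * q ^ k)"
    using assms(3,4) by (intro summable_mult summable_geometric) simp
  have "norm (infdist (z k) S) \<le> infdist (z 0) S * q ^ k" for k
    using geometric by (simp add: infdist_nonneg)
  then have "summable (\<lambda>k. infdist (z k) S)"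
    by (rule summable_comparison_test'[OF summable_bound])
  then have dist_zero: "(\<lambda>k. infdist (z k) S) \<longlonglongrightarrow> 0"
    and summable_steps: "summable (\<lambda>k. C * infdist (z k) S)"
    by (rule summable_LIMSEQ_zero, rule summable_mult)
  have "summable (\<lambda>k. z (Suc k) - z k)"
    by (rule summable_comparison_test'[OF summable_steps step])
  then have "(\<lambda>N. \<Sum>k<N. z (Suc k) - z k) \<longlonglongrightarrow> (\<Sum>k. z (Suc k) - z k)"
    by (rule summable_LIMSEQ)
  then have "(\<lambda>N. z N - z 0 + z 0) \<longlonglongrightarrow> (\<Sum>k. z (Suc k) - z k) + z 0"
    unfolding sum_lessThan_telescope by (intro tendsto_add tendsto_const)
  then obtain s where s: "z \<longlonglongrightarrow> s"
    unfolding diff_add_cancel by blast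
  then have "(\<lambda>k. infdist (z k) S) \<longlonglongrightarrow> infdist s S"
    by (rule tendsto_infdist)
  then have "infdist s S = 0"
    using dist_zero LIMSEQ_unique by blast
  then have "s \<in> S"
    using in_closed_iff_infdist_zero[OF assms(1,2)] by simp
  with s show ?thesis ..
qed

lemma reshuffle_schedule_range:
  assumes "reshuffle_schedule n \<xi>" "n \<ge> 1"
  shows "\<xi> k \<in> {1..n}"
proof -
  obtain \<pi> where \<pi>: "\<pi> permutes {1..n}" "\<forall>j<n. \<xi> (n * (k div n) + j) = \<pi> (j + 1)"
    using assms(1) unfolding reshuffle_schedule_def by blast
  have "k mod n < n"
    using assms(2) by simp
  then have "\<xi> k = \<pi> (k mod n + 1)" "k mod n + 1 \<in> {1..n}"
    using \<pi>(2)[rule_format, of "k mod n"] by simp_all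
  then show ?thesis
    using permutes_in_image[OF \<pi>(1)] by simp
qed

theorem theorem1:
  fixes l :: "nat \<Rightarrow> real ^ 'd \<Rightarrow> real"
    and n :: nat and L \<eta> :: real and \<mu> :: "nat \<Rightarrow> real"
    and \<xi> :: "nat \<Rightarrow> nat" and \<theta> :: "nat \<Rightarrow> real ^ 'd"
  assumes "n \<ge> 1"
    and "\<And>i x. i \<in> {1..n} \<Longrightarrow> l i differentiable (at x)"
    and "\<And>i. i \<in> {1..n} \<Longrightarrow> minimizers (l i) \<noteq> {}"
    and "minimizers (objective n l) \<noteq> {}"
    and "L > 0"
    and "\<And>i. i \<in> {1..n} \<Longrightarrow> 0 < \<mu> i \<and> \<mu> i \<le> L"
    and "\<And>i. i \<in> {1..n} \<Longrightarrow> L_smooth L (l i)"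
    and "\<And>i. i \<in> {1..n} \<Longrightarrow>
           weakly_strongly_convex (\<mu> i) (minimizers (objective n l)) (l i)"
    and "full_minimizer_coherence n l"
    and "0 < \<eta>" and "\<eta> \<le> 1 / L"
    and "reshuffle_schedule n \<xi>"
    and "SGD_trajectory l \<eta> \<xi> \<theta>"
  shows "\<exists>\<theta>s \<in> minimizers (objective n l). \<theta> \<longlonglongrightarrow> \<theta>s"
proof -
  let ?S = "minimizers (objective n l)"
  have "continuous_on UNIV (l i)" if "i \<in> {1..n}" for i
    using assms(2)[OF that] by (simp add: continuous_at_imp_continuous_on differentiable_imp_continuous_within)
  then have "continuous_on UNIV (objective n l)"
    unfolding objective_def by (intro continuous_intros)
  then have closed: "closed ?S"
    by (rule closed_minimizers)
  have sub: "?S \<subseteq> minimizers (l i)" if "i \<in> {1..n}" for i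
    using coherence_common_minimizers[OF assms(9) that] .
  have \<xi>: "\<xi> k \<in> {1..n}" for k
    using reshuffle_schedule_range[OF assms(12,1)] .
  have \<theta>: "\<theta> (Suc k) = \<theta> k - \<eta> *\<^sub>R grad (l (\<xi> k)) (\<theta> k)" for k
    using assms(13) unfolding SGD_trajectory_def by blast
  define m where "m = Min (\<mu> ` {1..n})"
  have m_le: "m \<le> \<mu> i" if "i \<in> {1..n}" for i
    unfolding m_def using that by simp
  have "m \<in> \<mu> ` {1..n}"
    unfolding m_def using assms(1) by (intro Min_in) auto
  then have m: "0 < m" "m \<le> L"
    using assms(6) by auto
  have "\<eta> * m \<le> \<eta> * L"
    using m(2) assms(10) by simp
  also have "\<dots> \<le> 1"
    using assms(5,11) by (simp add: field_simps)
  finally have \<eta>m: "\<eta> * m \<le> 1" .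
  have contr: "infdist (\<theta> (Suc k)) ?S \<le> sqrt (1 - \<eta> * m) * infdist (\<theta> k) ?S" for k
  proof (rule power2_le_imp_le)
    have "(infdist (\<theta> (Suc k)) ?S)\<^sup>2 \<le> (1 - \<eta> * \<mu> (\<xi> k)) * (infdist (\<theta> k) ?S)\<^sup>2"
      unfolding \<theta> using gradient_step_infdist_contracts
        [OF assms(7)[OF \<xi>] assms(5) assms(8)[OF \<xi>] closed assms(4) sub[OF \<xi>] assms(10,11)] .
    also have "\<dots> \<le> (1 - \<eta> * m) * (infdist (\<theta> k) ?S)\<^sup>2"
      using m_le[OF \<xi>] assms(10) by (intro mult_right_mono) auto
    also have "\<dots> = (sqrt (1 - \<eta> * m) * infdist (\<theta> k) ?S)\<^sup>2"
      using \<eta>m by (simp add: power_mult_distrib)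
    finally show "(infdist (\<theta> (Suc k)) ?S)\<^sup>2 \<le> (sqrt (1 - \<eta> * m) * infdist (\<theta> k) ?S)\<^sup>2" .
    show "0 \<le> sqrt (1 - \<eta> * m) * infdist (\<theta> k) ?S"
      using \<eta>m by (intro mult_nonneg_nonneg infdist_nonneg) simp
  qed
  have step: "norm (\<theta> (Suc k) - \<theta> k) \<le> (\<eta> * L) * infdist (\<theta> k) ?S" for k
    using assms(10)
      gradient_norm_le_infdist[OF assms(7)[OF \<xi>] assms(5) closed assms(4) sub[OF \<xi>], of k "\<theta> k"]
    by (simp add: \<theta>[of k] mult.assoc)
  have "0 \<le> sqrt (1 - \<eta> * m)" "sqrt (1 - \<eta> * m) < 1"
    using \<eta>m mult_pos_pos[OF assms(10) m(1)] by simp_all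
  then show ?thesis
    by (rule convergent_if_infdist_contracts[where z = \<theta> and C = "\<eta> * L", OF closed assms(4)])
      (rule contr step)+
qed

end
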